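(* Let $S$ be a system of ODEs on $[T_0,T_{\mathrm{end}}]$ which is split into disjoint subsystems $S_k$, $k=1,\dots,m$, of the form $$\dot{x}_{\mathcal D_k} = f_k\bigl(t,[x_{\mathcal D_k},x_{\mathcal I_k}]\bigr),$$ where $\mathcal D_k$ and $\mathcal I_k$ denote index sets ($\mathcal D_k$: the differential states of $S_k$; $\mathcal I_k$: the inputs of $S_k$, which are differential states of other subsystems). Let $(T_i)$ be a time grid of exchange times with width $H$. Let, on each exchange interval, the inputs $x_{\mathcal I_k}$ of all subsystems be extrapolated at $T_i$ with polynomial order $P$, and let the subsystems then be solved with a one-step method of order $p$ and maximal step width $h_\Delta\le H$ (explicit cosimulation scheme without iteration). Then there are constants $\tilde{\tilde C}, C, L>0$, independent of $h_\Delta$, $H$ and $j$, such that the error $\epsilon_{\Delta,S}(T_j)=x(T_j)-x_\Delta(T_j)$ of the numerical solution of the whole system satisfies, for all exchange times $T_{j+1}$, $$\|\epsilon_{\Delta,S}(T_{j+1})\| \le \frac{1}{L}\left(\tilde{\tilde C}\,h_\Delta^{p}+C\,H^{P+1}\right)\left(e^{L(T_{j+1}-T_0)}-1\right).$$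
   Context: The full state is $x$; the sets $\mathcal D_k$ partition its components and $\mathcal I_k$ is disjoint from $\mathcal D_k$. $x$ denotes the exact solution of the full coupled system $S$ with initial value $x(T_0)=x_0$, assumed sufficiently smooth (as are the $f_k$). Exchange times: $T_0<T_1<\dots<T_N=T_{\mathrm{end}}$, $H_{i+1}=T_{i+1}-T_i$, $H=\max_i H_i$. Within each exchange interval $[T_i,T_{i+1})$ the subsystem method takes steps of sizes $h_j$ whose sum is $T_{i+1}-T_i$; $h_\Delta$ is the maximum of all these step sizes. Cosimulation scheme: the numerical solution $x_\Delta$ starts at $x_\Delta(T_0)=x_0$. At $T_i$ the subsystems exchange data, and on $[T_i,T_{i+1})$ each subsystem $S_k$ solves $\dot{x}_{\mathcal D_k}=f_k(t,[x_{\mathcal D_k},\operatorname{Ext}(x_{\Delta,\mathcal I_k})(t)])$ separately, starting from $x_{\Delta,\mathcal D_k}(T_i)$, where $\operatorname{Ext}(x_{\Delta,\mathcal I_k})$ is a polynomial in $t$ of degree $P$ computed from the data (values and derivatives) of the inputs available at $T_i$. No iteration or repetition of intervals is performed. Extrapolation of order $P$: applied to exact data it satisfies $\|x_{\mathcal I_k}(t)-\operatorname{Ext}(x_{\mathcal I_k})(t)\|=O((t-T_i)^{P+1})$ on $[T_i,T_{i+1})$, uniformly in $i$, and $\operatorname{Ext}$ depends Lipschitz-continuously on the state at $T_i$. One-step method of order $p$: its discrete evolution has the form $\Psi^{t+h,t}x=x+h\,\psi(t,x,h)$, where the increment function $\psi$ is Lipschitz-continuous in $x$ (including the input components), and its consistency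 error $\Phi^{t+h,t}x-\Psi^{t+h,t}x$ is $O(h^{p+1})$ as $h\to0$, where $\Phi^{t+h,t}x$ is the exact solution at time $t+h$ of the initial value problem through $x$ at time $t$. The number $L$ is a Lipschitz constant associated with these Lipschitz conditions. *)

theory Defs
  imports "HOL-Analysis.Analysis"
begin

text \<open>
  For an index set \<open>A\<close>, the space of the component vectors \<open>x\<^sub>A\<close> is realised as the coordinate
  subspace \<open>coords A\<close> of \<open>real ^ 'n\<close>, components outside \<open>A\<close> being filled up with zeros.  For
  disjoint \<open>A\<close> and \<open>B\<close> the concatenation \<open>[x\<^sub>A, x\<^sub>B]\<close> is then the sum \<open>part A x + part B x\<close>.
\<close>

definition part :: "'n::finite set \<Rightarrow> real ^ 'n \<Rightarrow> real ^ 'n" where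
  "part A x = (\<chi> i. if i \<in> A then x $ i else 0)"

definition coords :: "'n::finite set \<Rightarrow> (real ^ 'n) set" where
  "coords A = {x. \<forall>i. i \<notin> A \<longrightarrow> x $ i = 0}"

text \<open>
  Functions of class \<open>C\<^sup>r\<close> on \<open>S\<close>: every directional derivative is of class \<open>C\<^sup>r\<^sup>-\<^sup>1\<close>; in finite
  dimension this is the usual notion.
\<close>

primrec C_diff_on :: "nat \<Rightarrow> ('a::euclidean_space \<Rightarrow> 'b::euclidean_space) \<Rightarrow> 'a set \<Rightarrow> bool" where
  "C_diff_on 0 = (\<lambda>g S. continuous_on S g)"
| "C_diff_on (Suc r) = (\<lambda>g S. \<exists>g'. (\<forall>x\<in>S. (g has_derivative g' x) (at x within S)) \<and>
     (\<forall>v. C_diff_on r (\<lambda>x. g' x v) S))"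


subsection \<open>The split system\<close>

definition split_index_sets :: "nat \<Rightarrow> (nat \<Rightarrow> 'n::finite set) \<Rightarrow> (nat \<Rightarrow> 'n set) \<Rightarrow> bool" where
  "split_index_sets m D I \<longleftrightarrow>
     disjoint_family_on D {1..m} \<and> (\<Union>k\<in>{1..m}. D k) = UNIV \<and> (\<forall>k\<in>{1..m}. I k \<inter> D k = {})"

definition subsystem_rhs ::
  "nat \<Rightarrow> real \<Rightarrow> real \<Rightarrow> 'n::finite set \<Rightarrow> 'n set \<Rightarrow> (real \<Rightarrow> real ^ 'n \<Rightarrow> real ^ 'n) \<Rightarrow> bool" where
  "subsystem_rhs r T\<^sub>0 T\<^sub>e Dk Ik fk \<longleftrightarrow>
     (\<forall>t\<in>{T\<^sub>0..T\<^sub>e}. \<forall>z\<in>coords (Dk \<union> Ik). fk t z \<in> coords Dk) \<and>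
     C_diff_on r (\<lambda>(t, z). fk t z) ({T\<^sub>0..T\<^sub>e} \<times> coords (Dk \<union> Ik))"

text \<open>\<open>y\<close> solves \<open>y' = f\<^sub>k(t, [y, u(t)])\<close> on \<open>{a..b}\<close> for the given input function \<open>u\<close>.\<close>

definition subsystem_solution ::
  "'n::finite set \<Rightarrow> (real \<Rightarrow> real ^ 'n \<Rightarrow> real ^ 'n) \<Rightarrow> (real \<Rightarrow> real ^ 'n) \<Rightarrow>
   (real \<Rightarrow> real ^ 'n) \<Rightarrow> real \<Rightarrow> real \<Rightarrow> bool" where
  "subsystem_solution Dk fk u y a b \<longleftrightarrow>
     (\<forall>t\<in>{a..b}. y t \<in> coords Dk \<and>
        (y has_vector_derivative fk t (y t + u t)) (at t within {a..b}))"

definition coupled_solution ::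
  "nat \<Rightarrow> (nat \<Rightarrow> 'n::finite set) \<Rightarrow> (nat \<Rightarrow> 'n set) \<Rightarrow> (nat \<Rightarrow> real \<Rightarrow> real ^ 'n \<Rightarrow> real ^ 'n) \<Rightarrow>
   (real \<Rightarrow> real ^ 'n) \<Rightarrow> real \<Rightarrow> real \<Rightarrow> bool" where
  "coupled_solution m D I f x a b \<longleftrightarrow>
     (\<forall>k\<in>{1..m}. subsystem_solution (D k) (f k)
        (\<lambda>t. part (I k) (x t)) (\<lambda>t. part (D k) (x t)) a b)"


subsection \<open>One-step methods for subsystems with inputs\<close>

text \<open>
  \<open>\<psi> u t y h\<close> is the increment function of the method applied to \<open>y' = f\<^sub>k(t, [y, u(t)])\<close>.  It
  takes the input as a function because a step from \<open>t\<close> to \<open>t + h\<close> may use its values on all of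
  \<open>{t..t + h}\<close>; Lipschitz continuity in the inputs is therefore with respect to the supremum norm
  on that interval.
\<close>

type_synonym 'n increment =
  "(real \<Rightarrow> real ^ 'n) \<Rightarrow> real \<Rightarrow> real ^ 'n \<Rightarrow> real \<Rightarrow> real ^ 'n"

definition input_function ::
  "nat \<Rightarrow> real \<Rightarrow> real \<Rightarrow> 'n::finite set \<Rightarrow> (real \<Rightarrow> real ^ 'n) \<Rightarrow> bool" where
  "input_function r T\<^sub>0 T\<^sub>e Ik u \<longleftrightarrow>
     (\<forall>t\<in>{T\<^sub>0..T\<^sub>e}. u t \<in> coords Ik) \<and> C_diff_on r u {T\<^sub>0..T\<^sub>e}"

text \<open>
  \<open>h\<^sub>m\<close> bounds the step sizes for which the method is used (implicit methods, for instance, are only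
  defined for small steps); \<open>h\<^sub>m = T\<^sub>e - T\<^sub>0\<close> means no restriction.
\<close>

definition admissible_step :: "real \<Rightarrow> real \<Rightarrow> real \<Rightarrow> real \<Rightarrow> real \<Rightarrow> bool" where
  "admissible_step T\<^sub>0 T\<^sub>e h\<^sub>m t h \<longleftrightarrow> T\<^sub>0 \<le> t \<and> 0 < h \<and> h \<le> h\<^sub>m \<and> t + h \<le> T\<^sub>e"

definition lipschitz_increment ::
  "nat \<Rightarrow> real \<Rightarrow> real \<Rightarrow> real \<Rightarrow> 'n::finite set \<Rightarrow> 'n set \<Rightarrow> 'n increment \<Rightarrow> bool" where
  "lipschitz_increment r T\<^sub>0 T\<^sub>e h\<^sub>m Dk Ik \<psi> \<longleftrightarrow>
     (\<exists>L. \<forall>u v t h. \<forall>y\<in>coords Dk. \<forall>z\<in>coords Dk.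
        input_function r T\<^sub>0 T\<^sub>e Ik u \<and> input_function r T\<^sub>0 T\<^sub>e Ik v \<and>
        admissible_step T\<^sub>0 T\<^sub>e h\<^sub>m t h \<longrightarrow>
        norm (\<psi> u t y h - \<psi> v t z h) \<le>
          L * (norm (y - z) + (SUP s\<in>{t..t + h}. norm (u s - v s))))"

text \<open>
  Order \<open>p\<close>: the consistency error is \<open>O(h\<^sup>p\<^sup>+\<^sup>1)\<close>, for each input function locally uniformly in the
  initial state and uniformly in the initial time.  The exact evolution enters through the
  solutions \<open>y\<close> on \<open>{t..t + h}\<close>.
\<close>

definition consistent_of_order ::
  "nat \<Rightarrow> nat \<Rightarrow> real \<Rightarrow> real \<Rightarrow> real \<Rightarrow> 'n::finite set \<Rightarrow> 'n set \<Rightarrow>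
   (real \<Rightarrow> real ^ 'n \<Rightarrow> real ^ 'n) \<Rightarrow> 'n increment \<Rightarrow> bool" where
  "consistent_of_order p r T\<^sub>0 T\<^sub>e h\<^sub>m Dk Ik fk \<psi> \<longleftrightarrow>
     (\<forall>u K. input_function r T\<^sub>0 T\<^sub>e Ik u \<and> compact K \<and> K \<subseteq> coords Dk \<longrightarrow>
        (\<exists>C. \<forall>t h y. admissible_step T\<^sub>0 T\<^sub>e h\<^sub>m t h \<and>
           subsystem_solution Dk fk u y t (t + h) \<and> y t \<in> K \<longrightarrow>
           norm (y (t + h) - (y t + h *\<^sub>R \<psi> u t (y t) h)) \<le> C * h ^ (p + 1)))"

definition one_step_method ::
  "nat \<Rightarrow> nat \<Rightarrow> real \<Rightarrow> real \<Rightarrow> real \<Rightarrow> 'n::finite set \<Rightarrow> 'n set \<Rightarrow>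
   (real \<Rightarrow> real ^ 'n \<Rightarrow> real ^ 'n) \<Rightarrow> 'n increment \<Rightarrow> bool" where
  "one_step_method p r T\<^sub>0 T\<^sub>e h\<^sub>m Dk Ik fk \<psi> \<longleftrightarrow>
     (\<forall>u t h. \<forall>y\<in>coords Dk. input_function r T\<^sub>0 T\<^sub>e Ik u \<and> admissible_step T\<^sub>0 T\<^sub>e h\<^sub>m t h \<longrightarrow>
        \<psi> u t y h \<in> coords Dk) \<and>
     lipschitz_increment r T\<^sub>0 T\<^sub>e h\<^sub>m Dk Ik \<psi> \<and>
     consistent_of_order p r T\<^sub>0 T\<^sub>e h\<^sub>m Dk Ik fk \<psi>"


subsection \<open>Extrapolation of the inputs\<close>

text \<open>
  \<open>E \<tau> z t\<close> is the value at time \<open>t\<close> of the polynomial extrapolating the inputs from exchange time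
  \<open>\<tau>\<close>, where \<open>z\<close> is the full state at \<open>\<tau>\<close>.  The full state is needed because the derivatives of the
  inputs at \<open>\<tau>\<close> are functions of it, via the differential equations.  Exact data means
  \<open>z = x \<tau>\<close>; as every point of \<open>{T\<^sub>0..<T\<^sub>e}\<close> is an exchange time of some grid, uniformity in the
  exchange time is uniformity in \<open>\<tau>\<close>.
\<close>

type_synonym 'n extrapolation = "real \<Rightarrow> real ^ 'n \<Rightarrow> real \<Rightarrow> real ^ 'n"

definition extrapolation_of_order ::
  "nat \<Rightarrow> real \<Rightarrow> real \<Rightarrow> 'n::finite set \<Rightarrow> (real \<Rightarrow> real ^ 'n) \<Rightarrow> 'n extrapolation \<Rightarrow> bool" where
  "extrapolation_of_order P T\<^sub>0 T\<^sub>e Ik x E \<longleftrightarrow>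
     (\<forall>\<tau>\<in>{T\<^sub>0..<T\<^sub>e}. \<forall>z. \<exists>c. (\<forall>l\<le>P. c l \<in> coords Ik) \<and>
        (\<forall>t. E \<tau> z t = (\<Sum>l\<le>P. (t - \<tau>) ^ l *\<^sub>R c l))) \<and>
     (\<exists>C. \<forall>\<tau>\<in>{T\<^sub>0..<T\<^sub>e}. \<forall>t\<in>{\<tau>..<T\<^sub>e}.
        norm (part Ik (x t) - E \<tau> (x \<tau>) t) \<le> C * (t - \<tau>) ^ (P + 1)) \<and>
     (\<exists>L. \<forall>\<tau>\<in>{T\<^sub>0..<T\<^sub>e}. \<forall>t\<in>{\<tau>..<T\<^sub>e}. \<forall>z w.
        norm (E \<tau> z t - E \<tau> w t) \<le> L * norm (z - w))"


subsection \<open>The explicit cosimulation scheme\<close>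

text \<open>
  \<open>hs k i\<close> lists the step sizes of the method for subsystem \<open>k\<close> on the exchange interval from
  \<open>T i\<close> to \<open>T (i + 1)\<close>; different subsystems may use different step sizes.
\<close>

definition cosim_grid ::
  "nat \<Rightarrow> real \<Rightarrow> real \<Rightarrow> nat \<Rightarrow> (nat \<Rightarrow> real) \<Rightarrow> (nat \<Rightarrow> nat \<Rightarrow> real list) \<Rightarrow> bool" where
  "cosim_grid m T\<^sub>0 T\<^sub>e N T hs \<longleftrightarrow>
     T 0 = T\<^sub>0 \<and> T N = T\<^sub>e \<and> (\<forall>i<N. T i < T (Suc i)) \<and>
     (\<forall>k\<in>{1..m}. \<forall>i<N. (\<forall>h\<in>set (hs k i). 0 < h) \<and> sum_list (hs k i) = T (Suc i) - T i)"

definition exchange_width :: "nat \<Rightarrow> (nat \<Rightarrow> real) \<Rightarrow> real" where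
  "exchange_width N T = Max ((\<lambda>i. T (Suc i) - T i) ` {..<N})"

definition max_step :: "nat \<Rightarrow> nat \<Rightarrow> (nat \<Rightarrow> nat \<Rightarrow> real list) \<Rightarrow> real" where
  "max_step m N hs = Max (\<Union>k\<in>{1..m}. \<Union>i<N. set (hs k i))"

primrec one_step_run ::
  "(real \<Rightarrow> 'a::real_vector \<Rightarrow> real \<Rightarrow> 'a) \<Rightarrow> real list \<Rightarrow> real \<Rightarrow> 'a \<Rightarrow> 'a" where
  "one_step_run \<phi> [] t y = y"
| "one_step_run \<phi> (h # hs) t y = one_step_run \<phi> hs (t + h) (y + h *\<^sub>R \<phi> t y h)"

text \<open>The numerical solution at the exchange times: \<open>cosim m D \<psi> E T hs x\<^sub>0 i\<close> is \<open>x\<^sub>\<Delta>(T i)\<close>.\<close>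

primrec cosim ::
  "nat \<Rightarrow> (nat \<Rightarrow> 'n::finite set) \<Rightarrow> (nat \<Rightarrow> 'n increment) \<Rightarrow> (nat \<Rightarrow> 'n extrapolation) \<Rightarrow>
   (nat \<Rightarrow> real) \<Rightarrow> (nat \<Rightarrow> nat \<Rightarrow> real list) \<Rightarrow> real ^ 'n \<Rightarrow> nat \<Rightarrow> real ^ 'n" where
  "cosim m D \<psi> E T hs x\<^sub>0 0 = x\<^sub>0"
| "cosim m D \<psi> E T hs x\<^sub>0 (Suc i) =
     (\<Sum>k\<in>{1..m}. part (D k)
        (one_step_run (\<psi> k (E k (T i) (cosim m D \<psi> E T hs x\<^sub>0 i))) (hs k i) (T i)
           (part (D k) (cosim m D \<psi> E T hs x\<^sub>0 i))))"

end

theory Submission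
  imports Defs
begin

text \<open>
  The crucial choice is where the consistency of the one-step methods is invoked: along the exact
  solution \<open>x\<close>, with its own components as inputs.  For these inputs \<open>x\<close> restricted to
  \<open>D k\<close> solves the \<open>k\<close>-th subsystem, and its values form a compact set, so a single consistency
  constant serves all steps on all grids.  (Consistency for the extrapolated inputs would not give
  uniform constants, as those inputs change with the grid.)  Replacing the exact inputs and the
  exact state by the extrapolated inputs and the numerical state is then paid for by the Lipschitz
  conditions.  With \<open>\<epsilon>\<close> the error at the last exchange time \<open>T i\<close>, \<open>e\<close> the current error of the
  subsystem, \<open>\<eta>\<close> a bound for the step sizes and \<open>H\<close> one for the exchange intervals, each step of
  length \<open>h\<close> changes \<open>e\<close> by at most \<open>h * B * (norm e + norm \<epsilon> + \<eta> ^ p + H ^ (P + 1))\<close>, where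
  \<open>B\<close> depends on the problem only (\<open>subsystem_step_defect\<close>).

  By a discrete Gronwall argument (\<open>one_step_run_error\<close>), \<open>e\<close> changes over an exchange interval of
  length \<open>\<Delta>\<close> by at most a multiple \<open>exp (B * \<Delta>) - 1\<close> of
  \<open>2 * norm \<epsilon> + \<eta> ^ p + H ^ (P + 1)\<close>.  It is essential to
  bound the \<^emph>\<open>change\<close> of the error and not the error itself: adding up bounds for the errors
  of the \<open>m\<close> subsystems would multiply the global error by \<open>m\<close> in each exchange interval, whereas
  the changes add up to a quantity of order \<open>\<Delta>\<close>.  With \<open>G = \<eta> ^ p + H ^ (P + 1)\<close>, Bernoulli's
  inequality turns the estimate for all subsystems together into
  \<open>norm \<epsilon>' + G \<le> exp (2 * m * B * \<Delta>) * (norm \<epsilon> + G)\<close> for the error \<open>\<epsilon>'\<close> at \<open>T (i + 1)\<close>.  The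
  factors telescope over the exchange intervals, and since the initial error is zero, the claim
  follows with all three constants equal to \<open>2 * m * B\<close>.
\<close>


section \<open>Coordinate subspaces\<close>

lemma part_in_coords: "part A v \<in> coords A"
  by (simp add: part_def coords_def)

lemma bounded_linear_part: "bounded_linear (part A)"
proof -
  have "linear (part A)"
    by (rule linearI) (auto simp: part_def vec_eq_iff)
  then show ?thesis
    by (rule linear_conv_bounded_linear[THEN iffD1])
qed

lemma norm_part_le: "norm (part A v) \<le> norm v"
  by (rule norm_le_componentwise_cart) (simp add: part_def)

lemma part_part: "part A (part A v) = part A v"
  by (simp add: part_def vec_eq_iff)

lemma coords_add_scaleR:
  assumes "y \<in> coords A" "v \<in> coords A"
  shows "y + c *\<^sub>R v \<in> coords A"
  using assms by (simp add: coords_def)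

lemma sum_part_eq:
  assumes "split_index_sets m D I"
  shows "(\<Sum>k\<in>{1..m}. part (D k) v) = v"
proof (simp add: vec_eq_iff, rule allI)
  fix i
  from assms obtain k where k: "k \<in> {1..m}" "i \<in> D k"
    unfolding split_index_sets_def by blast
  have other: "i \<notin> D l" if "l \<in> {1..m}" "l \<noteq> k" for l
    using assms k that unfolding split_index_sets_def disjoint_family_on_def by blast
  have "(\<Sum>l\<in>{1..m}. part (D l) v $ i) = (\<Sum>l\<in>{1..m}. if l = k then v $ i else 0)"
    by (rule sum.cong) (use k other in \<open>auto simp: part_def\<close>)
  then show "(\<Sum>l = Suc 0..m. part (D l) v $ i) = v $ i"
    using k by simp
qed

lemma split_index_sets_pos:
  assumes "split_index_sets m D I"
  shows "0 < m"
  using assms by (cases m) (auto simp: split_index_sets_def)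


section \<open>Admissible inputs\<close>

text \<open>
  The assumptions on the one-step methods quantify over inputs of class \<open>C\<^sup>r\<close>.  They are applied to
  the exact inputs, which inherit this class from \<open>x\<close>, and to the extrapolation polynomials.
\<close>

lemma C_diff_on_imp_continuous_on: "C_diff_on r g S \<Longrightarrow> continuous_on S g"
  by (cases r) (auto intro: has_derivative_continuous_on)

lemma C_diff_on_bounded_linear_compose:
  assumes "bounded_linear A" "C_diff_on r g S"
  shows "C_diff_on r (\<lambda>x. A (g x)) S"
  using assms(2)
proof (induction r arbitrary: g)
  case 0
  then show ?case
    using bounded_linear.continuous_on[OF assms(1)] by simp
next
  case (Suc r)
  then obtain g' where g': "\<And>x. x \<in> S \<Longrightarrow> (g has_derivative g' x) (at x within S)"
    "\<And>v. C_diff_on r (\<lambda>x. g' x v) S"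
    by auto
  show ?case
    unfolding C_diff_on.simps
    by (rule exI[of _ "\<lambda>x v. A (g' x v)"])
      (auto intro: bounded_linear.has_derivative[OF assms(1)] g' Suc.IH)
qed

lemma C_diff_on_add:
  assumes "C_diff_on r g S" "C_diff_on r h S"
  shows "C_diff_on r (\<lambda>x. g x + h x) S"
  using assms
proof (induction r arbitrary: g h)
  case 0
  then show ?case by (auto intro: continuous_on_add)
next
  case (Suc r)
  from Suc.prems obtain g' h' where
    g': "\<And>x. x \<in> S \<Longrightarrow> (g has_derivative g' x) (at x within S)" "\<And>v. C_diff_on r (\<lambda>x. g' x v) S" and
    h': "\<And>x. x \<in> S \<Longrightarrow> (h has_derivative h' x) (at x within S)" "\<And>v. C_diff_on r (\<lambda>x. h' x v) S"
    unfolding C_diff_on.simps by blast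
  show ?case
    unfolding C_diff_on.simps
    by (rule exI[of _ "\<lambda>x v. g' x v + h' x v"])
      (auto intro: has_derivative_add g' h' Suc.IH)
qed

lemma C_diff_on_monomial:
  fixes c :: "'b::euclidean_space" and S :: "real set"
  shows "C_diff_on r (\<lambda>t. (t - \<tau>) ^ l *\<^sub>R c) S"
proof (induction r arbitrary: l c)
  case 0
  show ?case by (auto intro!: continuous_intros)
next
  case (Suc r)
  have "((\<lambda>t. (t - \<tau>) ^ l *\<^sub>R c) has_derivative (\<lambda>v. (t - \<tau>) ^ (l - 1) *\<^sub>R ((of_nat l * v) *\<^sub>R c)))
      (at t within S)" for t
    by (auto intro!: derivative_eq_intros simp: algebra_simps)
  then show ?case
    unfolding C_diff_on.simps using Suc.IH
    by (intro exI[of _ "\<lambda>t v. (t - \<tau>) ^ (l - 1) *\<^sub>R ((of_nat l * v) *\<^sub>R c)"]) blast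
qed

lemma C_diff_on_polynomial:
  fixes c :: "nat \<Rightarrow> 'b::euclidean_space" and S :: "real set"
  shows "C_diff_on r (\<lambda>t. \<Sum>l\<le>P. (t - \<tau>) ^ l *\<^sub>R c l) S"
proof (induction P)
  case 0
  show ?case using C_diff_on_monomial[of r \<tau> 0 "c 0" S] by simp
next
  case (Suc P)
  show ?case
    using C_diff_on_add[OF Suc.IH C_diff_on_monomial[of r \<tau> "Suc P" "c (Suc P)" S]] by simp
qed

lemma exact_input_function:
  assumes "C_diff_on r x {T\<^sub>0..T\<^sub>e}"
  shows "input_function r T\<^sub>0 T\<^sub>e J (\<lambda>t. part J (x t))"
  unfolding input_function_def
  using part_in_coords C_diff_on_bounded_linear_compose[OF bounded_linear_part assms] by blast

lemma extrapolated_input_function: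
  assumes "extrapolation_of_order P T\<^sub>0 T\<^sub>e J x E" "\<tau> \<in> {T\<^sub>0..<T\<^sub>e}"
  shows "input_function r T\<^sub>0 T\<^sub>e J (E \<tau> z)"
proof -
  from assms obtain c where c: "\<forall>l\<le>P. c l \<in> coords J"
    "\<forall>t. E \<tau> z t = (\<Sum>l\<le>P. (t - \<tau>) ^ l *\<^sub>R c l)"
    unfolding extrapolation_of_order_def by meson
  from c(2) have "E \<tau> z = (\<lambda>t. \<Sum>l\<le>P. (t - \<tau>) ^ l *\<^sub>R c l)"
    by auto
  then show ?thesis
    using c(1) by (simp add: input_function_def C_diff_on_polynomial coords_def)
qed

text \<open>
  The bounds for the extrapolation exclude the end point \<open>T\<^sub>e\<close>, but the last step uses its input up
  to and including \<open>T\<^sub>e\<close>; continuity of both inputs closes the gap.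
\<close>

lemma extrapolation_error:
  assumes ext: "extrapolation_of_order P T\<^sub>0 T\<^sub>e J x E" and smooth: "C_diff_on r x {T\<^sub>0..T\<^sub>e}"
  shows "\<exists>C\<ge>0. \<forall>\<tau>\<in>{T\<^sub>0..<T\<^sub>e}. \<forall>t\<in>{\<tau>..T\<^sub>e}. \<forall>z.
    norm (part J (x t) - E \<tau> z t) \<le> C * ((t - \<tau>) ^ (P + 1) + norm (x \<tau> - z))"
proof -
  from ext obtain C\<^sub>0 L\<^sub>0 where
    C\<^sub>0: "\<And>\<tau> t. \<tau> \<in> {T\<^sub>0..<T\<^sub>e} \<Longrightarrow> t \<in> {\<tau>..<T\<^sub>e} \<Longrightarrow>
        norm (part J (x t) - E \<tau> (x \<tau>) t) \<le> C\<^sub>0 * (t - \<tau>) ^ (P + 1)" and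
    L\<^sub>0: "\<And>\<tau> t z w. \<tau> \<in> {T\<^sub>0..<T\<^sub>e} \<Longrightarrow> t \<in> {\<tau>..<T\<^sub>e} \<Longrightarrow>
        norm (E \<tau> z t - E \<tau> w t) \<le> L\<^sub>0 * norm (z - w)"
    unfolding extrapolation_of_order_def by metis
  define C where "C = \<bar>C\<^sub>0\<bar> + \<bar>L\<^sub>0\<bar>"
  have interior: "norm (part J (x t) - E \<tau> z t) \<le> C * ((t - \<tau>) ^ (P + 1) + norm (x \<tau> - z))"
    if \<tau>: "\<tau> \<in> {T\<^sub>0..<T\<^sub>e}" and t: "t \<in> {\<tau>..<T\<^sub>e}" for \<tau> t z
  proof -
    have "norm (part J (x t) - E \<tau> z t)
        \<le> norm (part J (x t) - E \<tau> (x \<tau>) t) + norm (E \<tau> (x \<tau>) t - E \<tau> z t)"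
      using norm_triangle_ineq[of "part J (x t) - E \<tau> (x \<tau>) t" "E \<tau> (x \<tau>) t - E \<tau> z t"] by simp
    also have "\<dots> \<le> C\<^sub>0 * (t - \<tau>) ^ (P + 1) + L\<^sub>0 * norm (x \<tau> - z)"
      using C\<^sub>0[OF \<tau> t] L\<^sub>0[OF \<tau> t] by (rule add_mono)
    also have "\<dots> \<le> C * (t - \<tau>) ^ (P + 1) + C * norm (x \<tau> - z)"
      using t by (intro add_mono mult_right_mono) (auto simp: C_def)
    finally show ?thesis by (simp add: distrib_left)
  qed
  have "norm (part J (x t) - E \<tau> z t) \<le> C * ((t - \<tau>) ^ (P + 1) + norm (x \<tau> - z))"
    if \<tau>: "\<tau> \<in> {T\<^sub>0..<T\<^sub>e}" and t: "t \<in> {\<tau>..T\<^sub>e}" for \<tau> t z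
  proof -
    have closure: "closure {\<tau>..<T\<^sub>e} = {\<tau>..T\<^sub>e}"
      using \<tau> by (auto simp: closure_atLeastLessThan)
    have sub: "{\<tau>..T\<^sub>e} \<subseteq> {T\<^sub>0..T\<^sub>e}"
      using \<tau> by auto
    have 1: "continuous_on {\<tau>..T\<^sub>e} (\<lambda>t. part J (x t))"
      using exact_input_function[OF smooth, of J] sub C_diff_on_imp_continuous_on continuous_on_subset
      unfolding input_function_def by blast
    have 2: "continuous_on {\<tau>..T\<^sub>e} (E \<tau> z)"
      using extrapolated_input_function[OF ext \<tau>, of r z] sub
        C_diff_on_imp_continuous_on continuous_on_subset
      unfolding input_function_def by blast
    have "norm (part J (x t) - E \<tau> z t) - C * ((t - \<tau>) ^ (P + 1) + norm (x \<tau> - z)) \<le> 0"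
    proof (rule continuous_le_on_closure[of "{\<tau>..<T\<^sub>e}"
          "\<lambda>t. norm (part J (x t) - E \<tau> z t) - C * ((t - \<tau>) ^ (P + 1) + norm (x \<tau> - z))"])
      show "continuous_on (closure {\<tau>..<T\<^sub>e})
          (\<lambda>t. norm (part J (x t) - E \<tau> z t) - C * ((t - \<tau>) ^ (P + 1) + norm (x \<tau> - z)))"
        unfolding closure by (intro continuous_intros 1 2)
    qed (use t closure interior[OF \<tau>] in auto)
    then show ?thesis by simp
  qed
  moreover have "0 \<le> C"
    by (simp add: C_def)
  ultimately show ?thesis by blast
qed


section \<open>A single step of a subsystem\<close>

text \<open>
  The defect splits into the consistency error along the exact solution and the perturbation of the
  increment function.  The former is \<open>O(h\<^sup>p\<^sup>+\<^sup>1)\<close> with a uniform constant, since \<open>x\<close> is continuous and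
  hence has compact range; the latter is controlled by the Lipschitz conditions.
\<close>

lemma subsystem_step_defect:
  assumes one_step: "one_step_method p r T\<^sub>0 T\<^sub>e h\<^sub>m Dk Ik fk \<psi>"
    and ext: "extrapolation_of_order P T\<^sub>0 T\<^sub>e Ik x E"
    and smooth: "C_diff_on r x {T\<^sub>0..T\<^sub>e}"
    and sol: "subsystem_solution Dk fk (\<lambda>t. part Ik (x t)) (\<lambda>t. part Dk (x t)) T\<^sub>0 T\<^sub>e"
  shows "\<exists>B\<ge>0. \<forall>\<tau> z t h y H \<eta>. T\<^sub>0 \<le> \<tau> \<and> \<tau> \<le> t \<and> 0 < h \<and> h \<le> h\<^sub>m \<and> t + h \<le> T\<^sub>e \<and>
      t + h - \<tau> \<le> H \<and> h \<le> \<eta> \<and> y \<in> coords Dk \<longrightarrow>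
    norm (part Dk (x (t + h)) - part Dk (x t) - h *\<^sub>R \<psi> (E \<tau> z) t y h) \<le>
      h * (B * (norm (part Dk (x t) - y) + (norm (x \<tau> - z) + (\<eta> ^ p + H ^ (P + 1)))))"
proof -
  define u where "u = (\<lambda>t. part Ik (x t))"
  define g where "g = (\<lambda>t. part Dk (x t))"
  have u: "input_function r T\<^sub>0 T\<^sub>e Ik u"
    unfolding u_def by (rule exact_input_function[OF smooth])
  have "continuous_on {T\<^sub>0..T\<^sub>e} g"
    unfolding g_def
    using C_diff_on_imp_continuous_on[OF smooth] bounded_linear.continuous_on[OF bounded_linear_part]
    by blast
  then have compact: "compact (g ` {T\<^sub>0..T\<^sub>e})"
    by (rule compact_continuous_image) simp
  have "g ` {T\<^sub>0..T\<^sub>e} \<subseteq> coords Dk"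
    by (auto simp: g_def part_in_coords)
  then have "\<exists>C. \<forall>t h y. admissible_step T\<^sub>0 T\<^sub>e h\<^sub>m t h \<and> subsystem_solution Dk fk u y t (t + h) \<and>
      y t \<in> g ` {T\<^sub>0..T\<^sub>e} \<longrightarrow> norm (y (t + h) - (y t + h *\<^sub>R \<psi> u t (y t) h)) \<le> C * h ^ (p + 1)"
    using one_step u compact unfolding one_step_method_def consistent_of_order_def by simp
  then obtain C where
    C: "\<And>t h y. admissible_step T\<^sub>0 T\<^sub>e h\<^sub>m t h \<Longrightarrow> subsystem_solution Dk fk u y t (t + h) \<Longrightarrow>
      y t \<in> g ` {T\<^sub>0..T\<^sub>e} \<Longrightarrow> norm (y (t + h) - (y t + h *\<^sub>R \<psi> u t (y t) h)) \<le> C * h ^ (p + 1)"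
    by blast
  from one_step have "lipschitz_increment r T\<^sub>0 T\<^sub>e h\<^sub>m Dk Ik \<psi>"
    by (simp add: one_step_method_def)
  then obtain L where
    L: "\<And>v w t h y z. y \<in> coords Dk \<Longrightarrow> z \<in> coords Dk \<Longrightarrow> input_function r T\<^sub>0 T\<^sub>e Ik v \<Longrightarrow>
      input_function r T\<^sub>0 T\<^sub>e Ik w \<Longrightarrow> admissible_step T\<^sub>0 T\<^sub>e h\<^sub>m t h \<Longrightarrow>
      norm (\<psi> v t y h - \<psi> w t z h) \<le> L * (norm (y - z) + (SUP s\<in>{t..t + h}. norm (v s - w s)))"
    unfolding lipschitz_increment_def by blast
  from extrapolation_error[OF ext smooth] obtain C\<^sub>E where "0 \<le> C\<^sub>E" and
    C\<^sub>E: "\<And>\<tau> t z. \<tau> \<in> {T\<^sub>0..<T\<^sub>e} \<Longrightarrow> t \<in> {\<tau>..T\<^sub>e} \<Longrightarrow>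
      norm (u t - E \<tau> z t) \<le> C\<^sub>E * ((t - \<tau>) ^ (P + 1) + norm (x \<tau> - z))"
    unfolding u_def by blast
  define B where "B = \<bar>L\<bar> * (1 + C\<^sub>E) + \<bar>C\<bar>"
  have "0 \<le> B"
    using \<open>0 \<le> C\<^sub>E\<close> by (simp add: B_def)
  moreover have "norm (g (t + h) - g t - h *\<^sub>R \<psi> (E \<tau> z) t y h) \<le>
      h * (B * (norm (g t - y) + (norm (x \<tau> - z) + (\<eta> ^ p + H ^ (P + 1)))))"
    if *: "T\<^sub>0 \<le> \<tau>" "\<tau> \<le> t" "0 < h" "h \<le> h\<^sub>m" "t + h \<le> T\<^sub>e" "t + h - \<tau> \<le> H" "h \<le> \<eta>"
      and y: "y \<in> coords Dk" for \<tau> z t h y H \<eta>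
  proof -
    have \<tau>: "\<tau> \<in> {T\<^sub>0..<T\<^sub>e}"
      using * by auto
    have step: "admissible_step T\<^sub>0 T\<^sub>e h\<^sub>m t h"
      using * by (auto simp: admissible_step_def)
    define e where "e = norm (g t - y)"
    define \<epsilon> where "\<epsilon> = norm (x \<tau> - z)"
    have nonneg: "0 \<le> e" "0 \<le> \<epsilon>" "0 \<le> \<eta> ^ p" "0 \<le> H ^ (P + 1)"
      using * by (auto simp: e_def \<epsilon>_def)
    have "subsystem_solution Dk fk u g t (t + h)"
      unfolding subsystem_solution_def
    proof (intro ballI conjI)
      fix s assume s: "s \<in> {t..t + h}"
      show "g s \<in> coords Dk"
        by (simp add: g_def part_in_coords)
      have "(g has_vector_derivative fk s (g s + u s)) (at s within {T\<^sub>0..T\<^sub>e})"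
        using sol s * unfolding subsystem_solution_def g_def u_def by simp
      then show "(g has_vector_derivative fk s (g s + u s)) (at s within {t..t + h})"
        by (rule has_vector_derivative_within_subset) (use * in auto)
    qed
    then have "norm (g (t + h) - (g t + h *\<^sub>R \<psi> u t (g t) h)) \<le> C * h ^ (p + 1)"
      using C[OF step] * by auto
    also have "\<dots> \<le> \<bar>C\<bar> * (h * \<eta> ^ p)"
      using * by (intro mult_mono) (auto intro: power_mono)
    finally have consistency:
      "norm (g (t + h) - (g t + h *\<^sub>R \<psi> u t (g t) h)) \<le> h * (\<bar>C\<bar> * \<eta> ^ p)"
      by (simp add: mult.left_commute)
    have inputs: "norm (u s - E \<tau> z s) \<le> C\<^sub>E * (H ^ (P + 1) + \<epsilon>)" if s: "s \<in> {t..t + h}" for s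
    proof -
      have "norm (u s - E \<tau> z s) \<le> C\<^sub>E * ((s - \<tau>) ^ (P + 1) + \<epsilon>)"
        unfolding \<epsilon>_def using C\<^sub>E[OF \<tau>, of s z] s * by auto
      also have "\<dots> \<le> C\<^sub>E * (H ^ (P + 1) + \<epsilon>)"
        using \<open>0 \<le> C\<^sub>E\<close> s * by (intro mult_left_mono add_right_mono power_mono) auto
      finally show ?thesis .
    qed
    have sup: "(SUP s\<in>{t..t + h}. norm (u s - E \<tau> z s)) \<le> C\<^sub>E * (H ^ (P + 1) + \<epsilon>)"
      using * inputs by (intro cSUP_least) auto
    \<comment> \<open>Since \<open>L\<close> may be negative, replacing it by \<open>\<bar>L\<bar>\<close> requires a nonnegative supremum.\<close>
    have "0 \<le> (SUP s\<in>{t..t + h}. norm (u s - E \<tau> z s))"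
    proof (rule cSUP_upper2[where x = t])
      show "bdd_above ((\<lambda>s. norm (u s - E \<tau> z s)) ` {t..t + h})"
        using inputs by (intro bdd_aboveI2) auto
    qed (use * in auto)
    then have "L * (e + (SUP s\<in>{t..t + h}. norm (u s - E \<tau> z s)))
        \<le> \<bar>L\<bar> * (e + C\<^sub>E * (H ^ (P + 1) + \<epsilon>))"
      using sup nonneg by (intro mult_mono) auto
    then have lip: "norm (\<psi> u t (g t) h - \<psi> (E \<tau> z) t y h) \<le> \<bar>L\<bar> * (e + C\<^sub>E * (H ^ (P + 1) + \<epsilon>))"
      using L[OF _ y u extrapolated_input_function[OF ext \<tau>] step, of "g t" z]
      by (simp add: e_def g_def part_in_coords)
    have "norm (g (t + h) - g t - h *\<^sub>R \<psi> (E \<tau> z) t y h) =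
        norm ((g (t + h) - (g t + h *\<^sub>R \<psi> u t (g t) h)) + h *\<^sub>R (\<psi> u t (g t) h - \<psi> (E \<tau> z) t y h))"
      by (simp add: algebra_simps)
    also have "\<dots> \<le> norm (g (t + h) - (g t + h *\<^sub>R \<psi> u t (g t) h))
        + h * norm (\<psi> u t (g t) h - \<psi> (E \<tau> z) t y h)"
      using * by (intro norm_triangle_le) simp
    also have "\<dots> \<le> h * (\<bar>C\<bar> * \<eta> ^ p) + h * (\<bar>L\<bar> * (e + C\<^sub>E * (H ^ (P + 1) + \<epsilon>)))"
      using consistency lip * by (intro add_mono mult_left_mono) auto
    also have "\<dots> = h * (\<bar>C\<bar> * \<eta> ^ p + \<bar>L\<bar> * (e + C\<^sub>E * (H ^ (P + 1) + \<epsilon>)))"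
      by (simp add: distrib_left)
    also have "\<dots> \<le> h * (B * (e + (\<epsilon> + (\<eta> ^ p + H ^ (P + 1)))))"
    proof (rule mult_left_mono)
      have "e + C\<^sub>E * (H ^ (P + 1) + \<epsilon>) \<le> (1 + C\<^sub>E) * (e + (\<epsilon> + (\<eta> ^ p + H ^ (P + 1))))"
        using nonneg \<open>0 \<le> C\<^sub>E\<close> by (simp add: algebra_simps del: power_Suc)
      then have "\<bar>L\<bar> * (e + C\<^sub>E * (H ^ (P + 1) + \<epsilon>))
          \<le> \<bar>L\<bar> * ((1 + C\<^sub>E) * (e + (\<epsilon> + (\<eta> ^ p + H ^ (P + 1)))))"
        by (rule mult_left_mono) simp
      moreover have "\<bar>C\<bar> * \<eta> ^ p \<le> \<bar>C\<bar> * (e + (\<epsilon> + (\<eta> ^ p + H ^ (P + 1))))"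
        using nonneg by (intro mult_left_mono) auto
      ultimately show "\<bar>C\<bar> * \<eta> ^ p + \<bar>L\<bar> * (e + C\<^sub>E * (H ^ (P + 1) + \<epsilon>))
          \<le> B * (e + (\<epsilon> + (\<eta> ^ p + H ^ (P + 1))))"
        unfolding B_def distrib_right mult.assoc by linarith
    qed (use * in simp)
    finally show ?thesis
      by (simp add: e_def \<epsilon>_def)
  qed
  ultimately show ?thesis
    by (intro exI[of _ B] conjI allI impI) (simp_all add: g_def)
qed


section \<open>Error propagation\<close>

text \<open>
  A discrete Gronwall lemma for the change of the error \<open>g - y\<close>.  Each step multiplies
  \<open>norm (g - y) + \<gamma>\<close> by at most \<open>1 + h * B\<close>, hence by at most \<open>exp (B * h)\<close>.  The invariant \<open>V\<close>
  is a set of states on which the bound for a step is available.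
\<close>

lemma one_step_run_error:
  fixes g :: "real \<Rightarrow> 'a::real_normed_vector"
  assumes "0 \<le> B" "0 \<le> \<gamma>" "\<And>h. h \<in> set hs \<Longrightarrow> 0 < h" "y \<in> V"
    and "\<And>t h y. h \<in> set hs \<Longrightarrow> a \<le> t \<Longrightarrow> t + h \<le> a + sum_list hs \<Longrightarrow> y \<in> V \<Longrightarrow>
      y + h *\<^sub>R \<phi> t y h \<in> V \<and>
      norm (g (t + h) - g t - h *\<^sub>R \<phi> t y h) \<le> h * (B * (norm (g t - y) + \<gamma>))"
  shows "norm ((g (a + sum_list hs) - one_step_run \<phi> hs a y) - (g a - y))
    \<le> (exp (B * sum_list hs) - 1) * (norm (g a - y) + \<gamma>)"
  using assms(3-)
proof (induction hs arbitrary: a y)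
  case Nil
  then show ?case by simp
next
  case (Cons h hs)
  define y' where "y' = y + h *\<^sub>R \<phi> a y h"
  define e where "e = g a - y"
  define e' where "e' = g (a + h) - y'"
  define q where "q = exp (B * sum_list hs) - 1"
  have h: "0 < h"
    using Cons.prems by simp
  have sum: "0 \<le> sum_list hs"
    using Cons.prems(1) by (intro sum_list_nonneg) (simp add: less_imp_le)
  have "y' \<in> V \<and> norm (g (a + h) - g a - h *\<^sub>R \<phi> a y h) \<le> h * (B * (norm e + \<gamma>))"
    unfolding y'_def e_def using Cons.prems(2) sum by (intro Cons.prems(3)) auto
  moreover have "e' - e = g (a + h) - g a - h *\<^sub>R \<phi> a y h"
    by (simp add: e_def e'_def y'_def)
  ultimately have y': "y' \<in> V" and step: "norm (e' - e) \<le> h * (B * (norm e + \<gamma>))"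
    by simp_all
  have IH: "norm ((g (a + h + sum_list hs) - one_step_run \<phi> hs (a + h) y') - e')
      \<le> q * (norm e' + \<gamma>)"
    unfolding q_def e'_def
  proof (intro Cons.IH y')
    show "\<And>h. h \<in> set hs \<Longrightarrow> 0 < h"
      using Cons.prems(1) by simp
    show "z + s *\<^sub>R \<phi> t z s \<in> V \<and>
        norm (g (t + s) - g t - s *\<^sub>R \<phi> t z s) \<le> s * (B * (norm (g t - z) + \<gamma>))"
      if "s \<in> set hs" "a + h \<le> t" "t + s \<le> a + h + sum_list hs" "z \<in> V" for t s z
      using that h by (intro Cons.prems(3)) auto
  qed
  have "norm e' \<le> norm e + norm (e' - e)"
    by (rule norm_triangle_sub)
  with step have "norm e' + \<gamma> \<le> (1 + B * h) * (norm e + \<gamma>)"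
    by (simp add: algebra_simps)
  moreover have "0 \<le> q"
    using assms(1) sum by (simp add: q_def)
  ultimately have "q * (norm e' + \<gamma>) \<le> q * ((1 + B * h) * (norm e + \<gamma>))"
    by (rule mult_left_mono)
  with IH step have "norm ((g (a + h + sum_list hs) - one_step_run \<phi> hs (a + h) y') - e)
      \<le> q * ((1 + B * h) * (norm e + \<gamma>)) + h * (B * (norm e + \<gamma>))"
    using norm_triangle_ineq[of "(g (a + h + sum_list hs) - one_step_run \<phi> hs (a + h) y') - e'" "e' - e"]
    by simp
  also have "\<dots> = ((1 + B * h) * (q + 1) - 1) * (norm e + \<gamma>)"
    by (simp add: algebra_simps)
  also have "\<dots> \<le> (exp (B * h) * (q + 1) - 1) * (norm e + \<gamma>)"
    using assms(2) \<open>0 \<le> q\<close> by (intro mult_right_mono diff_right_mono) (auto simp: exp_ge_add_one_self)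
  also have "exp (B * h) * (q + 1) = exp (B * (h + sum_list hs))"
    by (simp add: q_def exp_add distrib_left)
  finally show ?case
    by (simp add: e_def y'_def add.assoc)
qed

lemma one_plus_mult_exp_le:
  fixes s :: real
  shows "1 + real n * (exp s - 1) \<le> exp (real n * s)"
  using Bernoulli_inequality[of "exp s - 1" n] by (simp add: exp_of_nat_mult)

lemma grid_mono:
  assumes "cosim_grid m T\<^sub>0 T\<^sub>e N T hs" "i \<le> j" "j \<le> N"
  shows "T i \<le> T j"
  using assms(2,3)
proof (induction rule: dec_induct)
  case (step n)
  then have "T n < T (Suc n)"
    using assms(1) unfolding cosim_grid_def by auto
  with step show ?case by simp
qed simp

lemma exchange_interval_le_width: "i < N \<Longrightarrow> T (Suc i) - T i \<le> exchange_width N T"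
  unfolding exchange_width_def by (rule Max_ge) auto

lemma step_le_max_step:
  assumes "k \<in> {1..m}" "i < N" "h \<in> set (hs k i)"
  shows "h \<le> max_step m N hs"
  unfolding max_step_def using assms by (intro Max_ge) auto

text \<open>
  As the sets \<open>D k\<close> partition the components, the change of the global error over an exchange
  interval is the sum of the changes in the subsystems.  The error at the beginning of the interval
  therefore enters with the factor one, as it must for the factors to stay bounded when the number of
  intervals grows.
\<close>

lemma cosim_error_Suc:
  fixes x :: "real \<Rightarrow> real ^ 'b"
  assumes split: "split_index_sets m D I"
    and change: "\<And>k. k \<in> {1..m} \<Longrightarrow>
      norm ((part (D k) (x (T (Suc i)))
          - one_step_run (\<psi> k (E k (T i) (cosim m D \<psi> E T hs x\<^sub>0 i))) (hs k i) (T i)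
              (part (D k) (cosim m D \<psi> E T hs x\<^sub>0 i)))
        - (part (D k) (x (T i)) - part (D k) (cosim m D \<psi> E T hs x\<^sub>0 i))) \<le> \<delta>"
  shows "norm (x (T (Suc i)) - cosim m D \<psi> E T hs x\<^sub>0 (Suc i))
    \<le> norm (x (T i) - cosim m D \<psi> E T hs x\<^sub>0 i) + real m * \<delta>"
proof -
  define z where "z = cosim m D \<psi> E T hs x\<^sub>0 i"
  define w where "w k = one_step_run (\<psi> k (E k (T i) z)) (hs k i) (T i) (part (D k) z)" for k
  define c where "c k = (part (D k) (x (T (Suc i))) - w k) - (part (D k) (x (T i)) - part (D k) z)" for k
  have part_diff: "part A (v - w) = part A v - part A w" for A and v w :: "real ^ 'b"
    by (rule linear_diff) (rule bounded_linear.linear[OF bounded_linear_part])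
  have "(\<Sum>k\<in>{1..m}. part (D k) (c k))
      = (\<Sum>k\<in>{1..m}. part (D k) (x (T (Suc i)))) - (\<Sum>k\<in>{1..m}. part (D k) (w k))
        - ((\<Sum>k\<in>{1..m}. part (D k) (x (T i))) - (\<Sum>k\<in>{1..m}. part (D k) z))"
    by (simp add: c_def part_diff part_part sum_subtractf)
  also have "\<dots> = (x (T (Suc i)) - cosim m D \<psi> E T hs x\<^sub>0 (Suc i)) - (x (T i) - z)"
    unfolding sum_part_eq[OF split] by (simp add: w_def z_def)
  finally have "x (T (Suc i)) - cosim m D \<psi> E T hs x\<^sub>0 (Suc i)
      = (x (T i) - z) + (\<Sum>k\<in>{1..m}. part (D k) (c k))"
    by simp
  moreover have "norm (\<Sum>k\<in>{1..m}. part (D k) (c k)) \<le> real (card {1..m}) * \<delta>"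
  proof (rule order.trans[OF sum_norm_le sum_bounded_above])
    fix k assume "k \<in> {1..m}"
    then show "norm (c k) \<le> \<delta>"
      using change unfolding c_def w_def z_def by blast
  qed (rule norm_part_le)
  ultimately show ?thesis
    using norm_triangle_ineq[of "x (T i) - z" "\<Sum>k\<in>{1..m}. part (D k) (c k)"]
    by (simp add: z_def)
qed

theorem theorem3p6:
  fixes m p P r :: nat
    and T\<^sub>0 T\<^sub>e h\<^sub>m :: real
    and D I :: "nat \<Rightarrow> 'n::finite set"
    and f :: "nat \<Rightarrow> real \<Rightarrow> real ^ 'n \<Rightarrow> real ^ 'n"
    and x :: "real \<Rightarrow> real ^ 'n"
    and x\<^sub>0 :: "real ^ 'n"
    and \<psi> :: "nat \<Rightarrow> 'n increment"
    and E :: "nat \<Rightarrow> 'n extrapolation"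
  assumes "T\<^sub>0 < T\<^sub>e" and "0 < h\<^sub>m"
    and "split_index_sets m D I"
    and "\<forall>k\<in>{1..m}. subsystem_rhs r T\<^sub>0 T\<^sub>e (D k) (I k) (f k)"
    and "coupled_solution m D I f x T\<^sub>0 T\<^sub>e" and "x T\<^sub>0 = x\<^sub>0" and "C_diff_on r x {T\<^sub>0..T\<^sub>e}"
    and "\<forall>k\<in>{1..m}. one_step_method p r T\<^sub>0 T\<^sub>e h\<^sub>m (D k) (I k) (f k) (\<psi> k)"
    and "\<forall>k\<in>{1..m}. extrapolation_of_order P T\<^sub>0 T\<^sub>e (I k) x (E k)"
  shows "\<exists>C' C L. 0 < C' \<and> 0 < C \<and> 0 < L \<and>
    (\<forall>N T hs. cosim_grid m T\<^sub>0 T\<^sub>e N T hs \<and>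
        max_step m N hs \<le> exchange_width N T \<and> max_step m N hs \<le> h\<^sub>m \<longrightarrow>
      (\<forall>j<N. norm (x (T (Suc j)) - cosim m D \<psi> E T hs x\<^sub>0 (Suc j)) \<le>
         1 / L * (C' * max_step m N hs ^ p + C * exchange_width N T ^ (P + 1)) *
         (exp (L * (T (Suc j) - T\<^sub>0)) - 1)))"
proof -
  have "\<forall>k\<in>{1..m}. \<exists>B\<ge>0. \<forall>\<tau> z t h y H \<eta>. T\<^sub>0 \<le> \<tau> \<and> \<tau> \<le> t \<and> 0 < h \<and> h \<le> h\<^sub>m \<and> t + h \<le> T\<^sub>e \<and>
      t + h - \<tau> \<le> H \<and> h \<le> \<eta> \<and> y \<in> coords (D k) \<longrightarrow>
    norm (part (D k) (x (t + h)) - part (D k) (x t) - h *\<^sub>R \<psi> k (E k \<tau> z) t y h) \<le>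
      h * (B * (norm (part (D k) (x t) - y) + (norm (x \<tau> - z) + (\<eta> ^ p + H ^ (P + 1)))))"
    using assms(5,7,8,9) unfolding coupled_solution_def by (blast intro!: subsystem_step_defect)
  then obtain b where b: "\<And>k. k \<in> {1..m} \<Longrightarrow> 0 \<le> b k" and
    defect: "\<And>k \<tau> z t h y H \<eta>. k \<in> {1..m} \<Longrightarrow> T\<^sub>0 \<le> \<tau> \<Longrightarrow> \<tau> \<le> t \<Longrightarrow> 0 < h \<Longrightarrow> h \<le> h\<^sub>m \<Longrightarrow>
      t + h \<le> T\<^sub>e \<Longrightarrow> t + h - \<tau> \<le> H \<Longrightarrow> h \<le> \<eta> \<Longrightarrow> y \<in> coords (D k) \<Longrightarrow>
    norm (part (D k) (x (t + h)) - part (D k) (x t) - h *\<^sub>R \<psi> k (E k \<tau> z) t y h) \<le>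
      h * (b k * (norm (part (D k) (x t) - y) + (norm (x \<tau> - z) + (\<eta> ^ p + H ^ (P + 1)))))"
    by metis
  define B where "B = 1 + (\<Sum>k\<in>{1..m}. b k)"
  have "0 < B"
    using sum_nonneg[of "{1..m}" b] b by (simp add: B_def)
  have b_le: "b k \<le> B" if "k \<in> {1..m}" for k
    using member_le_sum[of k "{1..m}" b] that b by (simp add: B_def)
  \<comment> \<open>Each of the \<open>m\<close> subsystems contributes the old error twice: as its initial error and
    through the data of its extrapolated inputs.\<close>
  define L where "L = real (2 * m) * B"
  have "0 < L"
    using \<open>0 < B\<close> split_index_sets_pos[OF assms(3)] by (simp add: L_def)
  have "norm (x (T (Suc j)) - cosim m D \<psi> E T hs x\<^sub>0 (Suc j)) \<le>
      1 / L * (L * max_step m N hs ^ p + L * exchange_width N T ^ (P + 1)) *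
      (exp (L * (T (Suc j) - T\<^sub>0)) - 1)"
    if grid: "cosim_grid m T\<^sub>0 T\<^sub>e N T hs" and small: "max_step m N hs \<le> h\<^sub>m" and j: "j < N"
    for N T hs j
  proof -
    define \<eta> where "\<eta> = max_step m N hs"
    define H where "H = exchange_width N T"
    define G where "G = \<eta> ^ p + H ^ (P + 1)"
    define z where "z = cosim m D \<psi> E T hs x\<^sub>0"
    define err where "err i = norm (x (T i) - z i)" for i
    have T0: "T 0 = T\<^sub>0" and TN: "T N = T\<^sub>e"
      and hs_pos: "\<And>k i h. k \<in> {1..m} \<Longrightarrow> i < N \<Longrightarrow> h \<in> set (hs k i) \<Longrightarrow> 0 < h"
      and hs_sum: "\<And>k i. k \<in> {1..m} \<Longrightarrow> i < N \<Longrightarrow> sum_list (hs k i) = T (Suc i) - T i"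
      using grid unfolding cosim_grid_def by auto
    have T_less: "T i < T (Suc i)" if "i < N" for i
      using grid that unfolding cosim_grid_def by auto
    have "0 \<le> H"
      using exchange_interval_le_width[OF j, of T] T_less[OF j] by (simp add: H_def)
    have "0 \<le> \<eta>"
    proof -
      have one: "1 \<in> {1..m}"
        using split_index_sets_pos[OF assms(3)] by simp
      then have "hs 1 j \<noteq> []"
        using hs_sum[OF one j] T_less[OF j] by auto
      then obtain h where "h \<in> set (hs 1 j)"
        by (cases "hs 1 j") auto
      then show ?thesis
        using step_le_max_step[where hs = hs, OF one j] hs_pos[OF one j] unfolding \<eta>_def by fastforce
    qed
    have "0 \<le> G"
      using \<open>0 \<le> H\<close> \<open>0 \<le> \<eta>\<close> by (simp add: G_def)
    \<comment> \<open>Adding \<open>G\<close> on both sides makes the recursion for the errors purely multiplicative.\<close>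
    have err_Suc: "err (Suc i) + G \<le> exp (L * (T (Suc i) - T i)) * (err i + G)" if i: "i < N" for i
    proof -
      define \<Delta> where "\<Delta> = T (Suc i) - T i"
      have Ti: "T\<^sub>0 \<le> T i" "T (Suc i) \<le> T\<^sub>e"
        using grid_mono[OF grid, of 0 i] grid_mono[OF grid, of "Suc i" N] i by (auto simp: T0 TN)
      have q: "0 \<le> exp (B * \<Delta>) - 1"
        using \<open>0 < B\<close> T_less[OF i] by (simp add: \<Delta>_def)
      have change: "norm ((part (D k) (x (T (Suc i)))
            - one_step_run (\<psi> k (E k (T i) (z i))) (hs k i) (T i) (part (D k) (z i)))
          - (part (D k) (x (T i)) - part (D k) (z i)))
        \<le> (exp (B * \<Delta>) - 1) * (2 * (err i + G))" if k: "k \<in> {1..m}" for k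
      proof -
        have \<psi>: "\<psi> k (E k (T i) (z i)) t y h \<in> coords (D k)"
          if "admissible_step T\<^sub>0 T\<^sub>e h\<^sub>m t h" "y \<in> coords (D k)" for t y h
          using assms(8,9) k that extrapolated_input_function[of P T\<^sub>0 T\<^sub>e "I k" x "E k" "T i" r "z i"]
            Ti T_less[OF i]
          unfolding one_step_method_def by auto
        have run: "norm ((part (D k) (x (T i + sum_list (hs k i)))
              - one_step_run (\<psi> k (E k (T i) (z i))) (hs k i) (T i) (part (D k) (z i)))
            - (part (D k) (x (T i)) - part (D k) (z i)))
          \<le> (exp (B * sum_list (hs k i)) - 1)
            * (norm (part (D k) (x (T i)) - part (D k) (z i)) + (err i + G))"
        proof (rule one_step_run_error[where V = "coords (D k)"])
          fix t h y
          assume h: "h \<in> set (hs k i)" and t: "T i \<le> t" "t + h \<le> T i + sum_list (hs k i)"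
            and y: "y \<in> coords (D k)"
          have th: "0 < h" "h \<le> h\<^sub>m" "h \<le> \<eta>" "t + h \<le> T (Suc i)"
            using hs_pos[OF k i h] step_le_max_step[where hs = hs, OF k i h] small t hs_sum[OF k i]
            by (auto simp: \<eta>_def)
          have width: "t + h - T i \<le> H"
            using th exchange_interval_le_width[OF i, of T] by (simp add: H_def)
          have "admissible_step T\<^sub>0 T\<^sub>e h\<^sub>m t h"
            using th t Ti by (auto simp: admissible_step_def)
          then have "y + h *\<^sub>R \<psi> k (E k (T i) (z i)) t y h \<in> coords (D k)"
            using \<psi> y by (intro coords_add_scaleR) auto
          moreover have "norm (part (D k) (x (t + h)) - part (D k) (x t) - h *\<^sub>R \<psi> k (E k (T i) (z i)) t y h)
              \<le> h * (b k * (norm (part (D k) (x t) - y) + (err i + G)))"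
            unfolding err_def G_def using th t Ti width y k by (intro defect) auto
          moreover have "\<dots> \<le> h * (B * (norm (part (D k) (x t) - y) + (err i + G)))"
            using th b_le[OF k] \<open>0 \<le> G\<close> by (intro mult_left_mono mult_right_mono) (auto simp: err_def)
          ultimately show "y + h *\<^sub>R \<psi> k (E k (T i) (z i)) t y h \<in> coords (D k) \<and>
              norm (part (D k) (x (t + h)) - part (D k) (x t) - h *\<^sub>R \<psi> k (E k (T i) (z i)) t y h)
              \<le> h * (B * (norm (part (D k) (x t) - y) + (err i + G)))"
            by linarith
        qed (use \<open>0 < B\<close> \<open>0 \<le> G\<close> hs_pos[OF k i] in \<open>auto simp: err_def part_in_coords\<close>)
        have "norm (part (D k) (x (T i)) - part (D k) (z i)) \<le> err i"
          using norm_part_le[of "D k" "x (T i) - z i"]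
          by (simp add: err_def linear_diff bounded_linear.linear[OF bounded_linear_part])
        then have "(exp (B * \<Delta>) - 1) * (norm (part (D k) (x (T i)) - part (D k) (z i)) + (err i + G))
            \<le> (exp (B * \<Delta>) - 1) * (2 * (err i + G))"
          using q \<open>0 \<le> G\<close> by (intro mult_left_mono) auto
        with run show ?thesis
          unfolding hs_sum[OF k i] \<Delta>_def[symmetric] by (simp add: \<Delta>_def)
      qed
      have "err (Suc i) \<le> err i + real m * ((exp (B * \<Delta>) - 1) * (2 * (err i + G)))"
        unfolding err_def z_def
        by (rule cosim_error_Suc[OF assms(3)]) (use change in \<open>simp add: err_def z_def\<close>)
      then have "err (Suc i) + G \<le> (1 + real (2 * m) * (exp (B * \<Delta>) - 1)) * (err i + G)"
        by (simp add: algebra_simps)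
      also have "\<dots> \<le> exp (real (2 * m) * (B * \<Delta>)) * (err i + G)"
        using \<open>0 \<le> G\<close> by (intro mult_right_mono one_plus_mult_exp_le) (simp add: err_def)
      finally show ?thesis
        by (simp add: L_def \<Delta>_def mult.assoc)
    qed
    have "err i + G \<le> exp (L * (T i - T\<^sub>0)) * G" if "i \<le> N" for i
      using that
    proof (induction i)
      case 0
      show ?case by (simp add: err_def z_def T0 assms(6))
    next
      case (Suc i)
      have "err (Suc i) + G \<le> exp (L * (T (Suc i) - T i)) * (err i + G)"
        using Suc.prems by (intro err_Suc) simp
      also have "\<dots> \<le> exp (L * (T (Suc i) - T i)) * (exp (L * (T i - T\<^sub>0)) * G)"
        using Suc by (intro mult_left_mono) auto
      also have "\<dots> = exp (L * (T (Suc i) - T\<^sub>0)) * G"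
        by (simp add: mult.assoc[symmetric] exp_add[symmetric] algebra_simps)
      finally show ?case .
    qed
    from this[of "Suc j"] have "err (Suc j) \<le> G * (exp (L * (T (Suc j) - T\<^sub>0)) - 1)"
      using j by (simp add: algebra_simps)
    also have "G = 1 / L * (L * \<eta> ^ p + L * H ^ (P + 1))"
      using \<open>0 < L\<close> by (simp add: G_def field_simps)
    finally show ?thesis
      by (simp only: err_def z_def \<eta>_def H_def)
  qed
  then show ?thesis
    using \<open>0 < L\<close> by (intro exI[of _ L] conjI allI impI) blast+
qed

end
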